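(* Let $\mathcal{S}\subset\omega_4$ be a Segre variety $\mathcal{S}_3(2)$. Then $\mathcal{S}$ determines precisely four triplets $\mathcal{T}_i=\{\mathcal{F}_i,\mathcal{F}'_i,\mathcal{F}''_i\}$ ($i=1,2,3,4$) of fans with $\mathcal{F}_i\cup\mathcal{F}'_i\cup\mathcal{F}''_i=\mathcal{S}$, and the four resulting lines $L(\mathcal{T}_i)=\{c_{\mathcal{F}_i},c_{\mathcal{F}'_i},c_{\mathcal{F}''_i}\}$ are exactly the four lines $\mathbb{P}V_a,\mathbb{P}V_b,\mathbb{P}V_c,\mathbb{P}V_d$.
   Context: Work over $\mathbb{F}_2$. $V_8=V(8,2)$ with basis $e_1,\dots,e_8$, $V_a=\langle e_1,e_8\rangle$, $V_b=\langle e_2,e_7\rangle$, $V_c=\langle e_3,e_6\rangle$, $V_d=\langle e_4,e_5\rangle$; points of $\operatorname{PG}(7,2)$ are nonzero vectors; $\omega_4$ is the set of vectors all four of whose components in $V_a,\dots,V_d$ are nonzero. Let $\zeta_a: e_1\mapsto e_8\mapsto e_1+e_8\mapsto e_1$, $\zeta_b: e_7\mapsto e_2\mapsto e_2+e_7\mapsto e_7$, $\zeta_c: e_3\mapsto e_6\mapsto e_3+e_6\mapsto e_3$, $\zeta_d: e_5\mapsto e_4\mapsto e_4+e_5\mapsto e_5$; for $\lambda=ijkl\in\mathbb{F}_3^4$, $A_\lambda=\zeta_a^i\oplus\zeta_b^j\oplus\zeta_c^k\oplus\zeta_d^l$; $u=e_1+\dots+e_8$; $p_\lambda=A_\lambda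 u$ gives a bijection $\mathbb{F}_3^4\to\omega_4$. A Segre variety $\mathcal{S}_3(2)$ is the image under a linear isomorphism $\phi:V(2,2)^{\otimes3}\to V_8$ of the nonzero pure tensors; its generators are the $27$ lines obtained by letting one tensor factor vary with the other two fixed. A fan of $\mathcal{S}$ is a $9$-subset of $\mathcal{S}$ no two of whose points lie on a common generator. $\operatorname{hd}(p_\rho,p_\sigma)$ is the number of nonzero coordinates of $\rho-\sigma$ in the basis $\{1221,2121,2211,1111\}$ of $\mathbb{F}_3^4$; a troika is a set of three points of $\mathcal{S}$ pairwise at Hamming distance $3$, with centre the vector sum of its three points. Each fan $\mathcal{F}$ of such an $\mathcal{S}$ is uniquely a union of three troikas, all having the same centre, denoted $c_{\mathcal{F}}$; each fan $\mathcal{F}$ determines uniquely a triplet $\{\mathcal{F},\mathcal{F}',\mathcal{F}''\}$ of fans with union $\mathcal{S}$ (these are the "triplets of fans" of $\mathcal{S}$). *)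

theory Defs
  imports "HOL-Analysis.Analysis" "HOL-Library.Z2"
begin

type_synonym V8 = "bit ^ 8"

text \<open>The index 8 is the element 0 of the numeral type 8, so the basis vectors are
  basis_vec 1, ..., basis_vec 8 with eight distinct indices.\<close>

definition basis_vec :: "8 \<Rightarrow> V8" where
  "basis_vec i = axis i 1"

definition plane :: "8 \<Rightarrow> 8 \<Rightarrow> V8 set" where
  "plane s t = vec.span {basis_vec s, basis_vec t}"

definition V_a :: "V8 set" where "V_a = plane 1 8"
definition V_b :: "V8 set" where "V_b = plane 2 7"
definition V_c :: "V8 set" where "V_c = plane 3 6"
definition V_d :: "V8 set" where "V_d = plane 4 5"

definition proj_space :: "V8 set \<Rightarrow> V8 set" where
  "proj_space W = W - {0}"

definition component :: "8 \<Rightarrow> 8 \<Rightarrow> V8 \<Rightarrow> V8" where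
  "component s t v = v $ s *s basis_vec s + v $ t *s basis_vec t"

definition omega4 :: "V8 set" where
  "omega4 = {v. component 1 8 v \<noteq> 0 \<and> component 2 7 v \<noteq> 0 \<and>
                component 3 6 v \<noteq> 0 \<and> component 4 5 v \<noteq> 0}"

text \<open>The linear map zeta s t restricts to the 3-cycle of the lemma zeta_cycle on
  plane s t; only its values there are used.\<close>

definition zeta :: "8 \<Rightarrow> 8 \<Rightarrow> V8 \<Rightarrow> V8" where
  "zeta s t v = v $ s *s basis_vec t + v $ t *s (basis_vec s + basis_vec t)"

lemma zeta_cycle:
  assumes "s \<noteq> t"
  shows "zeta s t (basis_vec s) = basis_vec t"
    and "zeta s t (basis_vec t) = basis_vec s + basis_vec t"
    and "zeta s t (basis_vec s + basis_vec t) = basis_vec s"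
  using assms by (auto simp: zeta_def basis_vec_def axis_def vec_eq_iff)

text \<open>The type 3 is the ring of integers modulo 3, with representatives 0, 1, 2 given by
  Rep_bit1.\<close>

type_synonym F3 = 3

definition zeta_pow :: "8 \<Rightarrow> 8 \<Rightarrow> F3 \<Rightarrow> V8 \<Rightarrow> V8" where
  "zeta_pow s t i = zeta s t ^^ nat (Rep_bit1 i)"

definition A_map :: "F3 ^ 4 \<Rightarrow> V8 \<Rightarrow> V8" where
  "A_map l v = zeta_pow 1 8 (l $ 1) (component 1 8 v) +
           zeta_pow 7 2 (l $ 2) (component 7 2 v) +
           zeta_pow 3 6 (l $ 3) (component 3 6 v) +
           zeta_pow 5 4 (l $ 4) (component 5 4 v)"

definition u_vec :: V8 where
  "u_vec = (\<Sum>i\<in>UNIV. basis_vec i)"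

definition point :: "F3 ^ 4 \<Rightarrow> V8" where
  "point l = A_map l u_vec"

definition hd_basis :: "4 \<Rightarrow> F3 ^ 4" where
  "hd_basis i = vector [vector [1,2,2,1], vector [2,1,2,1], vector [2,2,1,1],
                        vector [1,1,1,1]] $ i"

definition hd_coords :: "F3 ^ 4 \<Rightarrow> F3 ^ 4" where
  "hd_coords d = (THE c. d = (\<Sum>i\<in>UNIV. c $ i *s hd_basis i))"

text \<open>The map point is a bijection from the labels to omega4, so hamming x y is
  meaningful for x and y in omega4.\<close>

definition hamming :: "V8 \<Rightarrow> V8 \<Rightarrow> nat" where
  "hamming x y = card {i. hd_coords (inv point x - inv point y) $ i \<noteq> 0}"

text \<open>The tensor cube of V(2,2) is modelled by 2 x 2 x 2 arrays of coefficients.\<close>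

type_synonym tensor3 = "bit ^ (2 \<times> 2 \<times> 2)"

definition pure_tensor :: "bit ^ 2 \<Rightarrow> bit ^ 2 \<Rightarrow> bit ^ 2 \<Rightarrow> tensor3" where
  "pure_tensor x y z = vec_lambda (\<lambda>(i, j, k). x $ i * y $ j * z $ k)"

definition linear_iso :: "(tensor3 \<Rightarrow> V8) \<Rightarrow> bool" where
  "linear_iso \<phi> \<longleftrightarrow> Vector_Spaces.linear (*s) (*s) \<phi> \<and> bij \<phi>"

definition segre :: "(tensor3 \<Rightarrow> V8) \<Rightarrow> V8 set" where
  "segre \<phi> = {\<phi> (pure_tensor x y z) | x y z. pure_tensor x y z \<noteq> 0}"

definition generators :: "(tensor3 \<Rightarrow> V8) \<Rightarrow> V8 set set" where
  "generators \<phi> =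
     {{\<phi> (pure_tensor x y z) | x. x \<noteq> 0} | y z. y \<noteq> 0 \<and> z \<noteq> 0} \<union>
     {{\<phi> (pure_tensor x y z) | y. y \<noteq> 0} | x z. x \<noteq> 0 \<and> z \<noteq> 0} \<union>
     {{\<phi> (pure_tensor x y z) | z. z \<noteq> 0} | x y. x \<noteq> 0 \<and> y \<noteq> 0}"

definition fan :: "(tensor3 \<Rightarrow> V8) \<Rightarrow> V8 set \<Rightarrow> bool" where
  "fan \<phi> F \<longleftrightarrow> F \<subseteq> segre \<phi> \<and> card F = 9 \<and>
     (\<forall>x\<in>F. \<forall>y\<in>F. x \<noteq> y \<longrightarrow> \<not> (\<exists>g\<in>generators \<phi>. x \<in> g \<and> y \<in> g))"

definition fan_triplets :: "(tensor3 \<Rightarrow> V8) \<Rightarrow> V8 set set set" where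
  "fan_triplets \<phi> = {\<T>. card \<T> = 3 \<and> (\<forall>F\<in>\<T>. fan \<phi> F) \<and> \<Union>\<T> = segre \<phi>}"

definition troika :: "V8 set \<Rightarrow> V8 set \<Rightarrow> bool" where
  "troika S T \<longleftrightarrow> T \<subseteq> S \<and> card T = 3 \<and> (\<forall>x\<in>T. \<forall>y\<in>T. x \<noteq> y \<longrightarrow> hamming x y = 3)"

definition centre :: "V8 set \<Rightarrow> V8" where
  "centre T = \<Sum>T"

definition fan_centre :: "V8 set \<Rightarrow> V8 set \<Rightarrow> V8" where
  "fan_centre S F = (THE c. \<exists>D. card D = 3 \<and> (\<forall>T\<in>D. troika S T \<and> centre T = c) \<and> \<Union>D = F)"

definition triplet_line :: "V8 set \<Rightarrow> V8 set set \<Rightarrow> V8 set" where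
  "triplet_line S \<T> = fan_centre S ` \<T>"

end

(*
  Each component of a vector of omega_4 is one of three nonzero vectors of a plane, which we label by
  the integers modulo 3.  Three nonzero vectors of a plane sum to 0 iff they are distinct.  Hence, when
  the 27 points of S are arranged in a 3 x 3 x 3 grid whose lines are the generators, each of the four
  component labels is a Latin cube, that is, an affine map c + s (a i + b j + k) with s, a, b = 1 or -1.
  The four directions (a, b, 1) are distinct: if two agreed, then two labels would determine each
  other up to an affine map, and a nonzero linear form would vanish on S, although S spans V_8.  So every
  (a, b, 1) with entries 1 or -1 occurs exactly once.  A fan is the graph of a Latin square, hence a plane
  a i + b j + k = const, i.e. the set of the points of S with a given component in one of V_a, ..., V_d.
  The four triplets are the four parallel classes.  The points of a troika in such a fan have all their
  labels in the other three planes distinct, so these components cancel in the centre, and the centre is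
  the common component.
*)
theory Submission
  imports Defs
begin

subsection \<open>Latin squares and cubes of order 3\<close>

lemma exhaust_F3: "x = 0 \<or> x = 1 \<or> x = (2::3)"
  using exhaust_3[of x] by auto

lemma forall_F3: "(\<forall>x::3. P x) \<longleftrightarrow> P 0 \<and> P 1 \<and> P 2"
  by (metis exhaust_F3)

lemma UNIV_F3: "(UNIV :: 3 set) = {0, 1, 2}"
  using exhaust_F3 by auto

lemma sum_F3: "(\<Sum>t\<in>(UNIV :: 3 set). f t) = f 0 + f 1 + f 2"
  unfolding UNIV_F3 by (simp add: ac_simps)

text \<open>Slope and offset give six affine maps, as many as there are permutations of three
  elements.\<close>

lemma inj_F3_affine:
  fixes f :: "3 \<Rightarrow> 3"
  assumes "inj f"
  shows "\<exists>a\<in>{1, -1}. \<exists>c. \<forall>i. f i = a * i + c"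
proof -
  have "f 0 \<noteq> f 1" "f 0 \<noteq> f 2" "f 1 \<noteq> f 2"
    using assms by (auto simp: inj_eq)
  then have "f 1 - f 0 \<in> {1, -1} \<and> (\<forall>i. f i = (f 1 - f 0) * i + f 0)"
    unfolding forall_F3 using exhaust_F3[of "f 0"] exhaust_F3[of "f 1"] exhaust_F3[of "f 2"]
    by auto
  then show ?thesis
    by blast
qed

text \<open>Each row is affine. Injective columns force equal slopes, and then the intercepts form a
  permutation themselves.\<close>

lemma latin_square_affine:
  fixes f :: "3 \<Rightarrow> 3 \<Rightarrow> 3"
  assumes row: "\<And>i. inj (f i)" and col: "\<And>j. inj (\<lambda>i. f i j)"
  shows "\<exists>a\<in>{1, -1}. \<exists>b\<in>{1, -1}. \<exists>c. \<forall>i j. f i j = a * i + b * j + c"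
proof -
  have "\<forall>i. \<exists>b\<in>{1, -1}. \<exists>c. \<forall>j. f i j = b * j + c"
    using inj_F3_affine row by blast
  then obtain b c where b: "\<And>i. b i \<in> {1, -1}" and f: "\<And>i j. f i j = b i * j + c i"
    by metis
  have "b i = b 0" for i
  proof (rule ccontr)
    assume ne: "b i \<noteq> b 0"
    \<comment> \<open>rows of different slope agree in some column\<close>
    have "b i * ((c 0 - c i) * (b i - b 0)) + c i = b 0 * ((c 0 - c i) * (b i - b 0)) + c 0"
      using ne b[of i] b[of 0] exhaust_F3[of "c i"] exhaust_F3[of "c 0"] by auto
    then have "f i ((c 0 - c i) * (b i - b 0)) = f 0 ((c 0 - c i) * (b i - b 0))"
      by (simp add: f)
    then have "i = 0"
      using col by (auto dest: injD)
    with ne show False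
      by simp
  qed
  then have f': "f i j = b 0 * j + c i" for i j
    using f by metis
  have "inj c"
    using col[of 0] by (simp add: f')
  then obtain a d where "a \<in> {1, -1}" "\<forall>i. c i = a * i + d"
    using inj_F3_affine by blast
  moreover from this f' have "\<forall>i j. f i j = a * i + b 0 * j + d"
    by (simp add: algebra_simps)
  ultimately show ?thesis
    using b[of 0] by blast
qed

text \<open>Each layer of fixed \<open>k\<close> is an affine Latin square; the slices
  \<open>j = 0\<close> and \<open>i = 0\<close> show that its slopes do not depend on
  \<open>k\<close> and that its intercept is affine in \<open>k\<close>. Splitting off
  \<open>s\<close> normalises the direction to \<open>(a, b, 1)\<close>.\<close>

lemma latin_cube_affine:
  fixes f :: "3 \<Rightarrow> 3 \<Rightarrow> 3 \<Rightarrow> 3"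
  assumes "\<And>i j. inj (f i j)" "\<And>i k. inj (\<lambda>j. f i j k)" "\<And>j k. inj (\<lambda>i. f i j k)"
  shows "\<exists>s\<in>{1, -1}. \<exists>a\<in>{1, -1}. \<exists>b\<in>{1, -1}. \<exists>c. \<forall>i j k. f i j k = s * (a * i + b * j + k) + c"
proof -
  have "\<forall>k. \<exists>a\<in>{1, -1}. \<exists>b\<in>{1, -1}. \<exists>c. \<forall>i j. f i j k = a * i + b * j + c"
    using latin_square_affine[of "\<lambda>i j. f i j k" for k] assms by blast
  then obtain A B C where "\<And>k. A k \<in> {1, -1}" "\<And>k. B k \<in> {1, -1}"
    and f: "\<And>i j k. f i j k = A k * i + B k * j + C k"
    by metis
  obtain a d c where a: "a \<in> {1, -1}" "d \<in> {1, -1}" and ac: "\<And>i k. f i 0 k = a * i + d * k + c"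
    using latin_square_affine[of "\<lambda>i k. f i 0 k"] assms by blast
  obtain b d' c' where b: "b \<in> {1, -1}" and bc: "\<And>j k. f 0 j k = b * j + d' * k + c'"
    using latin_square_affine[of "\<lambda>j k. f 0 j k"] assms by blast
  have C: "C k = d * k + c" for k
    using ac[of 0 k] f[of 0 0 k] by simp
  have A: "A k = a" for k
    using ac[of 1 k] f[of 1 0 k] C[of k] by simp
  have B: "B k = b" for k
    using bc[of 1 k] f[of 0 1 k] bc[of 0 k] f[of 0 0 k] by simp
  \<comment> \<open>The sign \<open>d\<close> is its own inverse, so it can be factored out.\<close>
  have "f i j k = d * (d * a * i + d * b * j + k) + c" for i j k
    using a(2) by (auto simp: f A B C)
  moreover have "d * a \<in> {1, -1}" "d * b \<in> {1, -1}"
    using a b by auto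
  ultimately show ?thesis
    using a(2) by blast
qed

subsection \<open>Labels of points\<close>

text \<open>Each plane has its two indices in the order in which its \<open>zeta\<close> is used in \<^const>\<open>A_map\<close>, so that
  \<open>plane_vec m t\<close> is the component of \<^const>\<open>u_vec\<close> rotated \<open>t\<close> times and \<open>lab v\<close> recovers the
  exponents \<open>ijkl\<close> of a point; \<open>lab\<close> is meaningful on \<^const>\<open>omega4\<close> only.\<close>

definition fst_ix :: "4 \<Rightarrow> 8" where
  "fst_ix m = (if m = 1 then 1 else if m = 2 then 7 else if m = 3 then 3 else 5)"

definition snd_ix :: "4 \<Rightarrow> 8" where
  "snd_ix m = (if m = 1 then 8 else if m = 2 then 2 else if m = 3 then 6 else 4)"

definition fst_bit :: "3 \<Rightarrow> bit" where
  "fst_bit t = (if t = 2 then 0 else 1)"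

definition snd_bit :: "3 \<Rightarrow> bit" where
  "snd_bit t = (if t = 1 then 0 else 1)"

definition plane_vec :: "4 \<Rightarrow> 3 \<Rightarrow> V8" where
  "plane_vec m t = fst_bit t *s basis_vec (fst_ix m) + snd_bit t *s basis_vec (snd_ix m)"

definition lab :: "V8 \<Rightarrow> 4 \<Rightarrow> 3" where
  "lab v m = (if v $ fst_ix m = v $ snd_ix m then 0 else if v $ fst_ix m = 1 then 1 else 2)"

lemma bits_simps [simp]:
  "fst_bit 0 = 1" "fst_bit 1 = 1" "fst_bit 2 = 0"
  "snd_bit 0 = 1" "snd_bit 1 = 0" "snd_bit 2 = 1"
  by (simp_all add: fst_bit_def snd_bit_def)

lemma ix_distinct [simp]:
  "fst_ix m \<noteq> snd_ix n" "snd_ix n \<noteq> fst_ix m"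
  "fst_ix m = fst_ix n \<longleftrightarrow> m = n" "snd_ix m = snd_ix n \<longleftrightarrow> m = n"
  using exhaust_4[of m] exhaust_4[of n] by (auto simp: fst_ix_def snd_ix_def)

lemma exhaust_F8:
  fixes i :: 8 shows "\<exists>m. i = fst_ix m \<or> i = snd_ix m"
proof (induct i)
  case (of_int z)
  then have "z = 0 \<or> z = 1 \<or> z = 2 \<or> z = 3 \<or> z = 4 \<or> z = 5 \<or> z = 6 \<or> z = 7"
    by simp arith
  moreover have "0 = snd_ix 1" "1 = fst_ix 1" "2 = snd_ix 2" "3 = fst_ix 3"
    "4 = snd_ix 4" "5 = fst_ix 4" "6 = snd_ix 3" "7 = fst_ix 2"
    by (simp_all add: fst_ix_def snd_ix_def)
  ultimately show ?case
    by (elim disjE) (simp; blast)+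
qed

lemma basis_vec_nth [simp]: "basis_vec i $ j = (if i = j then 1 else 0)"
  by (auto simp: basis_vec_def axis_def)

lemma V8_eq_iff: "v = w \<longleftrightarrow> (\<forall>m. v $ fst_ix m = w $ fst_ix m \<and> v $ snd_ix m = w $ snd_ix m)"
  by (metis vec_eq_iff exhaust_F8)

lemma plane_vec_nth [simp]:
  "plane_vec m t $ fst_ix n = (if m = n then fst_bit t else 0)"
  "plane_vec m t $ snd_ix n = (if m = n then snd_bit t else 0)"
  by (auto simp: plane_vec_def)

lemma component_eq_0_iff: "s \<noteq> t \<Longrightarrow> component s t v = 0 \<longleftrightarrow> v $ s = 0 \<and> v $ t = 0"
  by (auto simp: component_def vec_eq_iff)

lemma omega4_iff: "v \<in> omega4 \<longleftrightarrow> (\<forall>m. v $ fst_ix m = 1 \<or> v $ snd_ix m = 1)"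
  by (auto simp: omega4_def component_eq_0_iff forall_4 fst_ix_def snd_ix_def)

lemma bits_lab:
  assumes "v \<in> omega4"
  shows "fst_bit (lab v m) = v $ fst_ix m" "snd_bit (lab v m) = v $ snd_ix m"
  using assms[unfolded omega4_iff, rule_format, of m]
  by (cases "v $ fst_ix m"; cases "v $ snd_ix m"; simp add: lab_def)+

lemma lab_unique:
  assumes "v $ fst_ix m = fst_bit t" "v $ snd_ix m = snd_bit t"
  shows "lab v m = t"
  using assms exhaust_F3[of t] by (auto simp: lab_def)

lemma lab_decomposition: "v \<in> omega4 \<Longrightarrow> v = (\<Sum>m\<in>UNIV. plane_vec m (lab v m))"
  by (simp add: V8_eq_iff bits_lab)

lemma zeta_pow_u_vec:
  assumes "s \<noteq> t"
  shows "zeta_pow s t i (component s t u_vec) = fst_bit i *s basis_vec s + snd_bit i *s basis_vec t"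
proof -
  have u: "component s t u_vec = basis_vec s + basis_vec t"
    by (simp add: component_def u_vec_def)
  have "nat (Rep_bit1 (0::3)) = 0" "nat (Rep_bit1 (1::3)) = 1" "nat (Rep_bit1 (2::3)) = 2"
    by (simp_all add: bit1.Rep_0 bit1.Rep_1 bit1.Rep_numeral)
  then show ?thesis
    using exhaust_F3[of i] assms by (auto simp: zeta_pow_def u zeta_cycle numeral_2_eq_2)
qed

lemma point_eq: "point l = (\<Sum>m\<in>UNIV. plane_vec m (l $ m))"
  by (simp add: point_def A_map_def zeta_pow_u_vec sum_4 plane_vec_def fst_ix_def snd_ix_def)

lemma lab_point: "lab (point l) m = l $ m"
  by (rule lab_unique) (simp_all add: point_eq)

lemma inv_point: "v \<in> omega4 \<Longrightarrow> inv point v = vec_lambda (lab v)"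
proof (rule inv_f_eq)
  show "inj point"
    by (rule injI) (metis lab_point vec_eq_iff)
qed (simp add: point_eq flip: lab_decomposition)

section \<open>Hamming distance in terms of labels\<close>

lemma vector_4:
  "vector [x, y, z, w] $ 1 = x" "(vector [x, y, z, w] :: 'a::zero ^ 4) $ 2 = y"
  "(vector [x, y, z, w] :: 'a::zero ^ 4) $ 3 = z" "(vector [x, y, z, w] :: 'a::zero ^ 4) $ 4 = w"
  by (simp_all add: vector_def)

lemma hd_basis_nth:
  "hd_basis 1 $ 1 = 1" "hd_basis 1 $ 2 = 2" "hd_basis 1 $ 3 = 2" "hd_basis 1 $ 4 = 1"
  "hd_basis 2 $ 1 = 2" "hd_basis 2 $ 2 = 1" "hd_basis 2 $ 3 = 2" "hd_basis 2 $ 4 = 1"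
  "hd_basis 3 $ 1 = 2" "hd_basis 3 $ 2 = 2" "hd_basis 3 $ 3 = 1" "hd_basis 3 $ 4 = 1"
  "hd_basis 4 $ 1 = 1" "hd_basis 4 $ 2 = 1" "hd_basis 4 $ 3 = 1" "hd_basis 4 $ 4 = 1"
  by (simp_all add: hd_basis_def vector_4)

text \<open>Rows and columns have four entries 1 or -1, so their squares sum to 4 = 1. The basis
  matrix is orthogonal modulo 3, hence coordinates are scalar products: the columns yield existence,
  the rows uniqueness.\<close>

lemma hd_basis_orthogonal:
  "(\<Sum>j\<in>UNIV. hd_basis i $ j * hd_basis k $ j) = (if i = k then 1 else 0)"
  "(\<Sum>i\<in>UNIV. hd_basis i $ j * hd_basis i $ k) = (if j = k then 1 else 0)"
  using exhaust_4[of i] exhaust_4[of j] exhaust_4[of k]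
  by (elim disjE; simp add: sum_4 hd_basis_nth)+

lemma hd_coords_nth: "hd_coords d $ i = (\<Sum>j\<in>UNIV. hd_basis i $ j * d $ j)"
proof -
  have "hd_coords d = (\<chi> i. \<Sum>j\<in>UNIV. hd_basis i $ j * d $ j)"
    unfolding hd_coords_def
  proof (rule the_equality)
    show "d = (\<Sum>i\<in>UNIV. (\<chi> i. \<Sum>j\<in>UNIV. hd_basis i $ j * d $ j) $ i *s hd_basis i)"
    proof (intro vec_eq_iff[THEN iffD2] allI)
      fix k
      have "(\<Sum>i\<in>UNIV. \<Sum>j\<in>UNIV. hd_basis i $ j * d $ j * hd_basis i $ k) =
          (\<Sum>j\<in>UNIV. d $ j * (\<Sum>i\<in>UNIV. hd_basis i $ j * hd_basis i $ k))"
        by (subst sum.swap) (simp add: sum_distrib_left mult_ac)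
      then show "d $ k = (\<Sum>i\<in>UNIV. (\<chi> i. \<Sum>j\<in>UNIV. hd_basis i $ j * d $ j) $ i *s hd_basis i) $ k"
        by (simp add: hd_basis_orthogonal sum_distrib_right if_distrib cong: if_cong)
    qed
  next
    fix c :: "3 ^ 4"
    assume d: "d = (\<Sum>i\<in>UNIV. c $ i *s hd_basis i)"
    show "c = (\<chi> i. \<Sum>j\<in>UNIV. hd_basis i $ j * d $ j)"
    proof (intro vec_eq_iff[THEN iffD2] allI)
      fix i
      have "(\<Sum>j\<in>UNIV. \<Sum>k\<in>UNIV. hd_basis i $ j * (c $ k * hd_basis k $ j)) =
          (\<Sum>k\<in>UNIV. c $ k * (\<Sum>j\<in>UNIV. hd_basis i $ j * hd_basis k $ j))"
        by (subst sum.swap) (simp add: sum_distrib_left mult_ac)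
      then show "c $ i = (\<chi> i. \<Sum>j\<in>UNIV. hd_basis i $ j * d $ j) $ i"
        by (simp add: d hd_basis_orthogonal sum_distrib_left if_distrib cong: if_cong)
    qed
  qed
  then show ?thesis
    by simp
qed

lemma card_support_4:
  "card {i::4. P i} = of_bool (P 1) + of_bool (P 2) + of_bool (P 3) + of_bool (P 4)"
proof -
  have "card {i::4. P i} = (\<Sum>i\<in>UNIV. of_bool (P i))"
    by (simp add: Int_def)
  then show ?thesis
    by (simp add: sum_4)
qed

text \<open>If \<open>d\<close> vanishes at \<open>a\<close> and has 0, 1, 2 or 3 nonzero entries,
  then it has 0, 4, 2 or 3 nonzero Hamming coordinates, respectively.\<close>

lemma card_hd_coords_eq_3:
  assumes "d $ a = 0"
  shows "card {i. hd_coords d $ i \<noteq> 0} = 3 \<longleftrightarrow> (\<forall>m. m \<noteq> a \<longrightarrow> d $ m \<noteq> 0)"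
  using assms exhaust_4[of a] exhaust_F3[of "d $ 1"] exhaust_F3[of "d $ 2"]
    exhaust_F3[of "d $ 3"] exhaust_F3[of "d $ 4"]
  unfolding card_support_4 hd_coords_nth forall_4 sum_4
  by (elim disjE; simp add: hd_basis_nth)

lemma hamming_eq_3:
  assumes "x \<in> omega4" "y \<in> omega4" "lab x a = lab y a"
  shows "hamming x y = 3 \<longleftrightarrow> (\<forall>m. m \<noteq> a \<longrightarrow> lab x m \<noteq> lab y m)"
  using card_hd_coords_eq_3[of "vec_lambda (lab x) - vec_lambda (lab y)" a] assms
  by (simp add: hamming_def inv_point)

text \<open>Equal labels mean equal components in that plane, which cancel in the sum over
  \<open>bit\<close>. Applied to two points of a generator, whose third point is their sum.\<close>

lemma lab_neq:
  assumes "u \<in> omega4" "v \<in> omega4" "u + v \<in> omega4"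
  shows "lab u m \<noteq> lab v m"
proof
  assume "lab u m = lab v m"
  then have "u $ fst_ix m = v $ fst_ix m" "u $ snd_ix m = v $ snd_ix m"
    using assms(1,2) by (metis bits_lab)+
  with assms(3)[unfolded omega4_iff, rule_format, of m] show False
    by simp
qed

subsection \<open>Pure tensors\<close>

definition nonzero_vec :: "3 \<Rightarrow> bit ^ 2" where
  "nonzero_vec t = (\<chi> i. if i = 1 then fst_bit t else snd_bit t)"

lemma range_nonzero_vec: "range nonzero_vec = - {0}"
proof (intro equalityI subsetI)
  fix x :: "bit ^ 2"
  assume "x \<in> - {0}"
  then have "x = nonzero_vec (if x $ 1 = x $ 2 then 0 else if x $ 1 = 1 then 1 else 2)"
    by (cases "x $ 1"; cases "x $ 2"; simp add: nonzero_vec_def vec_eq_iff forall_2)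
  then show "x \<in> range nonzero_vec"
    by blast
qed (auto simp: nonzero_vec_def vec_eq_iff forall_2 fst_bit_def snd_bit_def)

lemma nonzero_vec_neq_0 [simp]: "nonzero_vec t \<noteq> 0"
  using range_nonzero_vec by auto

lemma nonzero_vec_cases: "x \<noteq> 0 \<Longrightarrow> \<exists>t. x = nonzero_vec t"
  using range_nonzero_vec by auto

lemma nonzero_vec_inject [simp]: "nonzero_vec s = nonzero_vec t \<longleftrightarrow> s = t"
  using exhaust_F3[of s] exhaust_F3[of t]
  by (elim disjE; simp add: nonzero_vec_def vec_eq_iff forall_2)

text \<open>The sum of two distinct nonzero vectors of a plane is the third one, and 0 + 1 + 2 = 0
  modulo 3.\<close>

lemma nonzero_vec_add:
  "s \<noteq> t \<Longrightarrow> nonzero_vec s + nonzero_vec t = nonzero_vec (- s - t)"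
  using exhaust_F3[of s] exhaust_F3[of t]
  by (elim disjE; simp add: nonzero_vec_def vec_eq_iff forall_2 fst_bit_def snd_bit_def)

lemma pure_tensor_nth [simp]: "pure_tensor x y z $ (i, j, k) = x $ i * y $ j * z $ k"
  by (simp add: pure_tensor_def)

lemma pure_tensor_eq_0_iff: "pure_tensor x y z = 0 \<longleftrightarrow> x = 0 \<or> y = 0 \<or> z = 0"
  by (simp add: vec_eq_iff)

lemma pure_tensor_add:
  "pure_tensor x y z + pure_tensor x' y z = pure_tensor (x + x') y z"
  "pure_tensor x y z + pure_tensor x y' z = pure_tensor x (y + y') z"
  "pure_tensor x y z + pure_tensor x y z' = pure_tensor x y (z + z')"
  by (simp_all add: vec_eq_iff algebra_simps)

text \<open>The only nonzero scalar is 1, so the factors carry no scaling ambiguity; each can be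
  read off along a line of entries through an entry equal to 1.\<close>

lemma pure_tensor_inject:
  assumes "pure_tensor x y z \<noteq> 0"
  shows "pure_tensor x y z = pure_tensor x' y' z' \<longleftrightarrow> x = x' \<and> y = y' \<and> z = z'"
proof
  assume eq: "pure_tensor x y z = pure_tensor x' y' z'"
  have "x \<noteq> 0" "y \<noteq> 0" "z \<noteq> 0"
    using assms by (auto simp: pure_tensor_eq_0_iff)
  then obtain i j k where "x $ i = 1" "y $ j = 1" "z $ k = 1"
    by (auto simp: vec_eq_iff)
  moreover have prod: "x $ i * y $ j * z $ k = x' $ i * y' $ j * z' $ k" for i j k
    using eq by (metis pure_tensor_nth)
  moreover from this have "x' $ i = 1 \<and> y' $ j = 1 \<and> z' $ k = 1"
    using calculation prod[of i j k] by (cases "x' $ i"; cases "y' $ j"; cases "z' $ k"; simp)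
  ultimately have "x $ i' = x' $ i'" "y $ j' = y' $ j'" "z $ k' = z' $ k'" for i' j' k'
    using prod[of i' j k] prod[of i j' k] prod[of i j k'] by (simp_all only: mult_1_left mult_1_right)
  then show "x = x' \<and> y = y' \<and> z = z'"
    by (simp add: vec_eq_iff)
qed simp

text \<open>The standard basis consists of pure tensors, which is why a Segre variety spans the
  whole space.\<close>

lemma axis_eq_pure_tensor: "axis (i, j, k) 1 = pure_tensor (axis i 1) (axis j 1) (axis k 1)"
  by (auto simp: vec_eq_iff axis_def)

text \<open>The three nonzero linear forms on plane \<open>m\<close>, indexed so that
  \<open>plane_vec m t\<close> is the nonzero vector of that plane killed by form
  \<open>t\<close>.\<close>

definition plane_form :: "4 \<Rightarrow> 3 \<Rightarrow> V8 \<Rightarrow> bit" where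
  "plane_form m t v = (if t = 0 then v $ fst_ix m + v $ snd_ix m
    else if t = 1 then v $ snd_ix m else v $ fst_ix m)"

lemma plane_form_eq_0_iff: "v \<in> omega4 \<Longrightarrow> plane_form m t v = 0 \<longleftrightarrow> lab v m = t"
  using exhaust_F3[of t] exhaust_F3[of "lab v m"]
  by (elim disjE; simp add: plane_form_def flip: bits_lab)

lemma plane_form_linear:
  "plane_form m t (\<Sum>i\<in>I. f i) = (\<Sum>i\<in>I. plane_form m t (f i))"
  "plane_form m t (c *s v) = c * plane_form m t v"
  by (cases "t = 0"; cases "t = 1"; simp only: plane_form_def if_True if_False simp_thms
      zero_neq_one sum_component vector_smult_component sum.distrib distrib_left)+

subsection \<open>Segre varieties in omega4\<close>

locale segre_in_omega4 =
  fixes \<phi> :: "tensor3 \<Rightarrow> V8"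
  assumes iso: "linear_iso \<phi>" and subset: "segre \<phi> \<subseteq> omega4"
begin

sublocale Vector_Spaces.linear "(*s)" "(*s)" \<phi>
  using iso by (simp add: linear_iso_def)

definition cell :: "3 \<Rightarrow> 3 \<Rightarrow> 3 \<Rightarrow> V8" where
  "cell i j k = \<phi> (pure_tensor (nonzero_vec i) (nonzero_vec j) (nonzero_vec k))"

lemma cell_inject [simp]: "cell i j k = cell i' j' k' \<longleftrightarrow> i = i' \<and> j = j' \<and> k = k'"
  using iso by (simp add: cell_def linear_iso_def bij_def inj_eq pure_tensor_inject pure_tensor_eq_0_iff)

lemma segre_eq: "segre \<phi> = {cell i j k | i j k. True}"
proof (intro equalityI subsetI)
  fix v
  assume "v \<in> segre \<phi>"
  then obtain x y z where "x \<noteq> 0" "y \<noteq> 0" "z \<noteq> 0" "v = \<phi> (pure_tensor x y z)"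
    by (auto simp: segre_def pure_tensor_eq_0_iff)
  then show "v \<in> {cell i j k | i j k. True}"
    unfolding cell_def by (blast dest: nonzero_vec_cases)
next
  fix v
  assume "v \<in> {cell i j k | i j k. True}"
  then show "v \<in> segre \<phi>"
    unfolding cell_def segre_def by (force simp: pure_tensor_eq_0_iff)
qed

lemma pure_tensor_in_segre: "x \<noteq> 0 \<Longrightarrow> y \<noteq> 0 \<Longrightarrow> z \<noteq> 0 \<Longrightarrow> \<phi> (pure_tensor x y z) \<in> segre \<phi>"
  unfolding segre_def pure_tensor_eq_0_iff by blast

lemma cell_in_segre [simp]: "cell i j k \<in> segre \<phi>"
  by (auto simp: segre_eq)

lemma cell_in_omega4 [simp]: "cell i j k \<in> omega4"
  using subset cell_in_segre by blast

lemma card_segre: "card (segre \<phi>) = 27"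
proof -
  have "segre \<phi> = (\<lambda>(i, j, k). cell i j k) ` UNIV"
    by (auto simp: segre_eq image_iff)
  then have "card (segre \<phi>) = card (UNIV :: (3 \<times> 3 \<times> 3) set)"
    by (simp add: card_image inj_on_def)
  then show ?thesis
    by (simp add: card_cartesian_product flip: UNIV_Times_UNIV)
qed

lemma generators_eq:
  "generators \<phi> = range (\<lambda>(j, k). range (\<lambda>i. cell i j k)) \<union> range (\<lambda>(i, k). range (\<lambda>j. cell i j k)) \<union>
    range (\<lambda>(i, j). range (cell i j))"
proof -
  have "{f x | x. x \<noteq> 0} = range (\<lambda>t. f (nonzero_vec t))" for f :: "bit ^ 2 \<Rightarrow> V8"
    by (auto dest: nonzero_vec_cases)
  moreover have "{f y z | y z. y \<noteq> 0 \<and> z \<noteq> 0} = range (\<lambda>(s, t). f (nonzero_vec s) (nonzero_vec t))"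
    for f :: "bit ^ 2 \<Rightarrow> bit ^ 2 \<Rightarrow> V8 set"
    by (auto simp: image_iff dest!: nonzero_vec_cases) (metis nonzero_vec_neq_0)
  ultimately show ?thesis
    by (simp add: generators_def cell_def)
qed

lemma on_generator_iff:
  "(\<exists>g\<in>generators \<phi>. cell i j k \<in> g \<and> cell i' j' k' \<in> g) \<longleftrightarrow>
    j = j' \<and> k = k' \<or> i = i' \<and> k = k' \<or> i = i' \<and> j = j'"
  by (auto simp: generators_eq bex_Un image_iff)

lemma cell_add:
  "i \<noteq> i' \<Longrightarrow> cell i j k + cell i' j k = cell (- i - i') j k"
  "j \<noteq> j' \<Longrightarrow> cell i j k + cell i j' k = cell i (- j - j') k"
  "k \<noteq> k' \<Longrightarrow> cell i j k + cell i j k' = cell i j (- k - k')"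
  by (simp_all add: cell_def pure_tensor_add nonzero_vec_add flip: add)

text \<open>The third point of a generator is the sum of the other two and lies in
  \<open>omega4\<close>, so labels are injective along generators and form a Latin cube.\<close>

lemma lab_cell_affine:
  "\<exists>s\<in>{1, -1}. \<exists>a\<in>{1, -1}. \<exists>b\<in>{1, -1}. \<exists>c. \<forall>i j k. lab (cell i j k) m = s * (a * i + b * j + k) + c"
proof (rule latin_cube_affine)
  show "inj (\<lambda>k. lab (cell i j k) m)" for i j
    by (rule injI, rule ccontr) (use lab_neq cell_add(3) in force)
  show "inj (\<lambda>j. lab (cell i j k) m)" for i k
    by (rule injI, rule ccontr) (use lab_neq cell_add(2) in force)
  show "inj (\<lambda>i. lab (cell i j k) m)" for j k
    by (rule injI, rule ccontr) (use lab_neq cell_add(1) in force)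
qed

lemma linear_form_eq_0:
  fixes f :: "V8 \<Rightarrow> bit"
  assumes lin: "\<And>g (I :: (2 \<times> 2 \<times> 2) set). f (sum g I) = (\<Sum>i\<in>I. f (g i))" "\<And>c v. f (c *s v) = c * f v"
    and vanish: "\<And>v. v \<in> segre \<phi> \<Longrightarrow> f v = 0"
  shows "f v = 0"
proof -
  have axis: "f (\<phi> (axis i 1)) = 0" for i
  proof (cases i)
    case (fields i1 i2 i3)
    then show ?thesis
      by (intro vanish) (simp add: axis_eq_pure_tensor pure_tensor_in_segre)
  qed
  obtain t where "v = \<phi> t"
    using iso by (auto simp: linear_iso_def bij_def surj_def)
  also have "\<dots> = \<phi> (\<Sum>i\<in>UNIV. t $ i *s axis i 1)"
    by (simp add: basis_expansion)
  also have "f \<dots> = (\<Sum>i\<in>UNIV. t $ i * f (\<phi> (axis i 1)))"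
    by (simp only: sum scale lin)
  finally show ?thesis
    by (simp add: axis)
qed

text \<open>Under such a relation two forms, one for each plane, vanish at the same points of the
  variety. Over \<open>bit\<close> their sum then vanishes on the variety, hence everywhere.\<close>

lemma labels_independent:
  assumes "m \<noteq> n" "s \<in> {1, -1}"
  shows "\<not> (\<forall>v\<in>segre \<phi>. lab v n = s * lab v m + c)"
proof
  assume "\<forall>v\<in>segre \<phi>. lab v n = s * lab v m + c"
  then have "lab v m = 0 \<longleftrightarrow> lab v n = c" if "v \<in> segre \<phi>" for v
    using that assms(2) by auto
  then have *: "plane_form m 0 v + plane_form n c v = 0" if "v \<in> segre \<phi>" for v
    using that subset plane_form_eq_0_iff[of v m 0] plane_form_eq_0_iff[of v n c]
    by (cases "plane_form m 0 v"; cases "plane_form n c v") auto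
  have "plane_form m 0 v + plane_form n c v = 0" for v
    by (rule linear_form_eq_0[of "\<lambda>v. plane_form m 0 v + plane_form n c v"])
       (simp_all only: plane_form_linear sum.distrib distrib_left *)
  \<comment> \<open>This vector lies in plane \<open>m\<close>: the first form takes the value 1
    there, the second the value 0.\<close>
  from this[of "basis_vec (fst_ix m)"] show False
    using assms(1) by (simp add: plane_form_def split: if_splits)
qed

end

section \<open>The directions of the four labels\<close>

locale labelled_segre = segre_in_omega4 +
  fixes s a b c :: "4 \<Rightarrow> 3"
  assumes signs: "s m \<in> {1, -1}" "a m \<in> {1, -1}" "b m \<in> {1, -1}"
    and lab_cell: "lab (cell i j k) m = s m * (a m * i + b m * j + k) + c m"

lemma (in segre_in_omega4) ex_labelled_segre: "\<exists>s a b c. labelled_segre \<phi> s a b c"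
proof -
  obtain s a b c where
    "\<forall>m. s m \<in> {1, -1} \<and> a m \<in> {1, -1} \<and> b m \<in> {1, -1} \<and>
      (\<forall>i j k. lab (cell i j k) m = s m * (a m * i + b m * j + k) + c m)"
    using lab_cell_affine by metis
  then have "labelled_segre \<phi> s a b c"
    by unfold_locales auto
  then show ?thesis
    by blast
qed

context labelled_segre
begin

text \<open>Labels of equal direction have the same linear part up to sign, so each is an affine
  function of the other, contrary to \<open>labels_independent\<close>.\<close>

lemma directions_distinct:
  assumes "m \<noteq> n"
  shows "(a m, b m) \<noteq> (a n, b n)"
proof
  assume "(a m, b m) = (a n, b n)"
  then have "lab v n = s n * s m * lab v m + (c n - s n * s m * c m)" if "v \<in> segre \<phi>" for v
    using that signs(1)[of m] signs(1)[of n] by (auto simp: segre_eq lab_cell algebra_simps)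
  moreover have "s n * s m \<in> {1, -1}"
    using signs(1)[of m] signs(1)[of n] by auto
  ultimately show False
    using labels_independent[OF assms] by blast
qed

lemma direction_exists:
  assumes "x \<in> {1, -1}" "y \<in> {1, -1}"
  shows "\<exists>m. a m = x \<and> b m = y"
proof -
  have "inj (\<lambda>m. (a m, b m))"
    using directions_distinct by (auto intro: injI)
  then have "card (range (\<lambda>m. (a m, b m))) = card ({1, -1} \<times> {1, -1} :: (3 \<times> 3) set)"
    by (simp add: card_image card_cartesian_product)
  moreover have "range (\<lambda>m. (a m, b m)) \<subseteq> {1, -1} \<times> {1, -1}"
    using signs by blast
  ultimately have "range (\<lambda>m. (a m, b m)) = {1, -1} \<times> {1, -1}"
    by (intro card_subset_eq) auto
  moreover have "(x, y) \<in> {1, -1} \<times> {1, -1}"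
    using assms by blast
  ultimately show ?thesis
    by (metis (mono_tags, lifting) imageE prod.inject)
qed

section \<open>Fans as planes of the grid\<close>

definition fan_of :: "4 \<Rightarrow> 3 \<Rightarrow> V8 set" where
  "fan_of m t = {v \<in> segre \<phi>. lab v m = t}"

lemma cell_in_fan_of: "cell i j k \<in> fan_of m t \<longleftrightarrow> k = s m * (t - c m) - a m * i - b m * j"
  using signs(1)[of m] by (auto simp: fan_of_def lab_cell algebra_simps)

lemma fan_of_eq: "fan_of m t = range (\<lambda>(i, j). cell i j (s m * (t - c m) - a m * i - b m * j))"
proof -
  have "v \<in> fan_of m t \<longleftrightarrow> (\<exists>i j. v = cell i j (s m * (t - c m) - a m * i - b m * j))" for v
  proof (cases "v \<in> segre \<phi>")
    case True
    then obtain i j k where "v = cell i j k"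
      by (auto simp: segre_eq)
    then show ?thesis
      by (simp add: cell_in_fan_of)
  qed (auto simp: fan_of_def)
  then show ?thesis
    by (auto simp: image_iff)
qed

lemma card_fan_of: "card (fan_of m t) = 9"
proof -
  have "card (fan_of m t) = card (UNIV :: (3 \<times> 3) set)"
    unfolding fan_of_eq by (intro card_image) (auto intro: inj_onI)
  then show ?thesis
    by (simp add: card_cartesian_product flip: UNIV_Times_UNIV)
qed

lemma fan_fan_of: "fan \<phi> (fan_of m t)"
  unfolding fan_def
proof (intro conjI ballI impI)
  fix x y
  assume "x \<in> fan_of m t" "y \<in> fan_of m t" "x \<noteq> y"
  then obtain i j k i' j' k' where
    x: "x = cell i j k" "k = s m * (t - c m) - a m * i - b m * j" and
    y: "y = cell i' j' k'" "k' = s m * (t - c m) - a m * i' - b m * j'" and "(i, j) \<noteq> (i', j')"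
    by (auto simp: fan_of_eq)
  then have "\<not> (j = j' \<and> k = k' \<or> i = i' \<and> k = k' \<or> i = i' \<and> j = j')"
    using signs(2)[of m] signs(3)[of m] by auto
  then show "\<not> (\<exists>g\<in>generators \<phi>. x \<in> g \<and> y \<in> g)"
    by (simp only: x(1) y(1) on_generator_iff not_False_eq_True)
next
  show "card (fan_of m t) = 9"
    by (rule card_fan_of)
qed (auto simp: fan_of_def)

text \<open>A fan is the graph of a Latin square.\<close>

lemma fan_imp_fan_of:
  assumes "fan \<phi> F"
  shows "\<exists>m t. F = fan_of m t"
proof -
  define X where "X = {(i, j, k). cell i j k \<in> F}"
  have F: "F = (\<lambda>(i, j, k). cell i j k) ` X"
  proof (intro equalityI subsetI)
    fix v
    assume "v \<in> F"
    moreover from this obtain i j k where "v = cell i j k"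
      using assms by (auto simp: fan_def segre_eq)
    ultimately show "v \<in> (\<lambda>(i, j, k). cell i j k) ` X"
      by (auto simp: X_def image_iff)
  qed (auto simp: X_def)
  have card: "card X = 9"
    using assms unfolding fan_def F by (subst (asm) card_image) (auto simp: inj_on_def)
  have agree: "i = i' \<and> j = j' \<and> k = k'"
    if "cell i j k \<in> F" "cell i' j' k' \<in> F" "j = j' \<and> k = k' \<or> i = i' \<and> k = k' \<or> i = i' \<and> j = j'"
    for i j k i' j' k'
  proof -
    have "cell i j k = cell i' j' k'"
    proof (rule ccontr)
      assume "cell i j k \<noteq> cell i' j' k'"
      then have "\<not> (\<exists>g\<in>generators \<phi>. cell i j k \<in> g \<and> cell i' j' k' \<in> g)"
        using assms that(1,2) unfolding fan_def by blast
      then show False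
        using that(3) unfolding on_generator_iff by blast
    qed
    then show ?thesis
      by simp
  qed
  \<comment> \<open>Nine points with distinct pairs \<open>(i, j)\<close> exhaust all nine pairs, so
    the fan is the graph of a total function \<open>f\<close>.\<close>
  have "inj_on (\<lambda>(i, j, k). (i, j)) X"
    by (auto simp: inj_on_def X_def dest: agree)
  then have "card ((\<lambda>(i, j, k). (i, j)) ` X) = card (UNIV :: (3 \<times> 3) set)"
    by (simp add: card_image card card_cartesian_product flip: UNIV_Times_UNIV)
  then have "(\<lambda>(i, j, k). (i, j)) ` X = UNIV"
    by (intro card_subset_eq) auto
  then have "(i, j) \<in> (\<lambda>(i, j, k). (i, j)) ` X" for i j
    by blast
  then have "\<exists>k. cell i j k \<in> F" for i j
    by (fastforce simp: X_def)
  then obtain f where f: "\<And>i j. cell i j (f i j) \<in> F"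
    by metis
  then have k: "k = f i j" if "cell i j k \<in> F" for i j k
    using that agree by blast
  have "inj (f i)" "inj (\<lambda>i. f i j)" for i j
    using agree f by (metis injI)+
  then obtain p q d where pq: "p \<in> {1, -1}" "q \<in> {1, -1}" and d: "\<And>i j. f i j = p * i + q * j + d"
    using latin_square_affine[of f] by blast
  \<comment> \<open>The graph \<open>k = p * i + q * j + d\<close> is a plane of direction
    \<open>(- p, - q, 1)\<close>.\<close>
  then have "- p \<in> {1, -1}" "- q \<in> {1, -1}"
    by auto
  then obtain m where m: "a m = - p" "b m = - q"
    using direction_exists by blast
  \<comment> \<open>The linear part \<open>a m * i + b m * j + k\<close> is constantly
    \<open>d\<close> on the graph, which determines the label.\<close>
  have "F \<subseteq> fan_of m (s m * d + c m)"
  proof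
    fix v
    assume "v \<in> F"
    moreover from this obtain i j l where "v = cell i j l"
      using assms by (auto simp: fan_def segre_eq)
    ultimately have "v = cell i j (f i j)"
      using k by blast
    then show "v \<in> fan_of m (s m * d + c m)"
      using m d by (simp add: fan_of_def lab_cell)
  qed
  moreover have "finite (fan_of m (s m * d + c m))"
    by (rule card_ge_0_finite) (simp add: card_fan_of)
  ultimately have "F = fan_of m (s m * d + c m)"
    using assms by (intro card_subset_eq) (auto simp: card_fan_of fan_def)
  then show ?thesis
    by blast
qed

text \<open>Planes of different directions are not parallel; a common point already exists with
  \<open>i = 0\<close> or \<open>j = 0\<close>.\<close>

lemma fan_of_meets:
  assumes "m \<noteq> n"
  shows "fan_of m t \<inter> fan_of n u \<noteq> {}"
proof -
  define x y where "x = s m * (t - c m)" and "y = s n * (u - c n)"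
  have "\<exists>i j. x - a m * i - b m * j = y - a n * i - b n * j"
  proof (cases "a m = a n")
    case True
    \<comment> \<open>Here \<open>b n = - b m\<close>, so \<open>j\<close> must satisfy
      \<open>2 * b m * j = x - y\<close>; the factor \<open>2 * b m\<close> is its own
      inverse.\<close>
    then have "x - a m * 0 - b m * (2 * b m * (x - y)) = y - a n * 0 - b n * (2 * b m * (x - y))"
      using directions_distinct[OF assms] signs(3)[of m] signs(3)[of n]
        exhaust_F3[of x] exhaust_F3[of y] by auto
    then show ?thesis
      by blast
  next
    case False
    then have "x - a m * (2 * a m * (x - y)) - b m * 0 = y - a n * (2 * a m * (x - y)) - b n * 0"
      using signs(2)[of m] signs(2)[of n] exhaust_F3[of x] exhaust_F3[of y] by auto
    then show ?thesis
      by blast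
  qed
  then obtain i j where "cell i j (x - a m * i - b m * j) \<in> fan_of m t \<inter> fan_of n u"
    unfolding x_def y_def by (auto simp: cell_in_fan_of)
  then show ?thesis
    by blast
qed

lemma inj_fan_of: "inj (fan_of m)"
proof (rule injI)
  fix t u
  assume "fan_of m t = fan_of m u"
  moreover obtain v where "v \<in> fan_of m t"
    using card_fan_of[of m t] by fastforce
  ultimately show "t = u"
    by (auto simp: fan_of_def)
qed

text \<open>Three fans of 9 points covering 27 points are disjoint, whereas fans of different
  directions meet. A triplet is therefore a full parallel class.\<close>

lemma fan_triplets_eq: "fan_triplets \<phi> = range (\<lambda>m. range (fan_of m))"
proof (intro equalityI subsetI)
  fix \<T>
  assume "\<T> \<in> range (\<lambda>m. range (fan_of m))"
  then obtain m where "\<T> = range (fan_of m)"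
    by blast
  then show "\<T> \<in> fan_triplets \<phi>"
    using inj_fan_of[of m] fan_fan_of
    by (auto simp: fan_triplets_def card_image) (auto simp: fan_of_def)
next
  fix \<T>
  assume "\<T> \<in> fan_triplets \<phi>"
  then have \<T>: "card \<T> = 3" "\<And>F. F \<in> \<T> \<Longrightarrow> fan \<phi> F" "\<Union>\<T> = segre \<phi>"
    by (auto simp: fan_triplets_def)
  have card9: "card F = 9" if "F \<in> \<T>" for F
    using \<T>(2)[OF that] by (simp add: fan_def)
  then have fin: "finite F" if "F \<in> \<T>" for F
    using that by (metis card.infinite zero_neq_numeral)
  have disjnt: "F \<inter> G = {}" if "F \<in> \<T>" "G \<in> \<T>" "F \<noteq> G" for F G
  proof -
    have "card (\<T> - {F, G}) = 1"
      using that \<T>(1) by (subst card_Diff_subset) auto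
    then obtain H where "\<T> - {F, G} = {H}"
      by (auto simp: card_1_singleton_iff)
    then have H: "\<T> = {F, G, H}"
      using that by blast
    then have "H \<in> \<T>"
      by blast
    have "27 = card ((F \<union> G) \<union> H)"
      using \<T>(3) H card_segre by (simp add: Un_assoc)
    also have "\<dots> \<le> card (F \<union> G) + card H"
      by (rule card_Un_le)
    finally have "card (F \<inter> G) = 0"
      using card_Un_Int[OF fin fin, OF that(1,2)] that(1,2) \<open>H \<in> \<T>\<close>[THEN card9]
        that(1,2)[THEN card9] by linarith
    then show ?thesis
      using that by (simp add: fin)
  qed
  obtain F where "F \<in> \<T>"
    using \<T>(1) by fastforce
  then obtain m t where F: "F = fan_of m t"
    using \<T>(2) fan_imp_fan_of by blast
  have "\<T> \<subseteq> range (fan_of m)"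
  proof
    fix G
    assume G: "G \<in> \<T>"
    then obtain n u where "G = fan_of n u"
      using \<T>(2) fan_imp_fan_of by blast
    then show "G \<in> range (fan_of m)"
      using disjnt[OF \<open>F \<in> \<T>\<close> G] fan_of_meets[of m n t u] F by blast
  qed
  then have "\<T> = range (fan_of m)"
    using \<T>(1) inj_fan_of by (intro card_subset_eq) (auto simp: card_image)
  then show "\<T> \<in> range (\<lambda>m. range (fan_of m))"
    by blast
qed

section \<open>Troikas and centres of fans\<close>

lemma fan_of_subset_omega4: "fan_of m t \<subseteq> omega4"
  using subset by (auto simp: fan_of_def)

text \<open>Summed plane by plane: in plane \<open>m\<close> three equal vectors add up to one copy
  over \<open>bit\<close>; in any other plane Hamming distance 3 makes the labels distinct, and the
  three nonzero vectors cancel.\<close>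

lemma centre_troika:
  assumes "troika S T" "T \<subseteq> fan_of m t"
  shows "centre T = plane_vec m t"
proof -
  have T: "card T = 3" "finite T" and hd: "\<And>x y. x \<in> T \<Longrightarrow> y \<in> T \<Longrightarrow> x \<noteq> y \<Longrightarrow> hamming x y = 3"
    using assms(1) by (auto simp: troika_def intro: card_ge_0_finite)
  have T_om: "x \<in> omega4" if "x \<in> T" for x
    using that assms(2) fan_of_subset_omega4 by blast
  have T_m: "lab x m = t" if "x \<in> T" for x
    using that assms(2) by (auto simp: fan_of_def)
  have "(\<Sum>v\<in>T. plane_vec n (lab v n)) = (if n = m then plane_vec m t else 0)" for n
  proof (cases "n = m")
    case True
    then have "(\<Sum>v\<in>T. plane_vec n (lab v n)) = (\<Sum>v\<in>T. plane_vec m t)"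
      using T_m by (intro sum.cong) auto
    then show ?thesis
      using True by (simp add: V8_eq_iff T(1) del: bits_simps)
  next
    case False
    then have inj: "inj_on (\<lambda>v. lab v n) T"
      using hd hamming_eq_3 T_om T_m by (metis (mono_tags, lifting) inj_onI)
    then have "(\<lambda>v. lab v n) ` T = UNIV"
      using T(1) by (intro card_subset_eq) (auto simp: card_image)
    then have "(\<Sum>v\<in>T. plane_vec n (lab v n)) = (\<Sum>t\<in>UNIV. plane_vec n t)"
      using sum.reindex[OF inj, of "plane_vec n"] by simp
    also have "\<dots> = 0"
      by (simp add: sum_F3 V8_eq_iff)
    finally show ?thesis
      using False by simp
  qed
  then have "(\<Sum>n\<in>UNIV. \<Sum>v\<in>T. plane_vec n (lab v n)) = plane_vec m t"
    by simp
  moreover have "centre T = (\<Sum>v\<in>T. \<Sum>n\<in>UNIV. plane_vec n (lab v n))"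
    unfolding centre_def using T_om lab_decomposition by (intro sum.cong) auto
  ultimately show ?thesis
    by (simp add: sum.swap[of _ T])
qed

text \<open>The fans of a triplet are parallel planes in the grid; their troikas are the lines in the direction
  \<open>(a m, b m, 1)\<close>, which is isotropic for the standard scalar product modulo 3.\<close>

definition troika_of :: "4 \<Rightarrow> 3 \<Rightarrow> 3 \<Rightarrow> V8 set" where
  "troika_of m t r =
    range (\<lambda>n. cell (a m * (s m * (t - c m) - b m * r) + a m * n) (r + b m * n) n)"

text \<open>Along a line of direction \<open>m\<close>, label \<open>l\<close> changes by the scalar
  product of directions \<open>l\<close> and \<open>m\<close>, up to sign. This is 0 for
  \<open>l = m\<close>; otherwise one or two signs differ and it is 1 or -1.\<close>

lemma troika_troika_of: "troika (segre \<phi>) (troika_of m t r)"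
  unfolding troika_def
proof (intro conjI ballI impI)
  show "troika_of m t r \<subseteq> segre \<phi>"
    by (auto simp: troika_of_def)
  have "card (troika_of m t r) = CARD(3)"
    unfolding troika_of_def by (intro card_image) (auto intro: injI)
  then show "card (troika_of m t r) = 3"
    by simp
  fix x y
  assume "x \<in> troika_of m t r" "y \<in> troika_of m t r" "x \<noteq> y"
  then obtain i j n n' where
    x: "x = cell (i + a m * n) (j + b m * n) n" and
    y: "y = cell (i + a m * n') (j + b m * n') n'" and "n \<noteq> n'"
    unfolding troika_of_def by blast
  have diff: "lab x l - lab y l = s l * (a l * a m + b l * b m + 1) * (n - n')" for l
    by (simp add: x y lab_cell algebra_simps)
  have "a m * a m + b m * b m + 1 = 0"
    using signs(2,3)[of m] by auto
  then have "lab x m = lab y m"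
    using diff[of m] by simp
  moreover have "lab x l \<noteq> lab y l" if "l \<noteq> m" for l
    using diff[of l] signs[of m] signs[of l] directions_distinct[OF that] \<open>n \<noteq> n'\<close> by auto
  ultimately show "hamming x y = 3"
    using hamming_eq_3[of x y m] x y by simp
qed

text \<open>The lines of direction \<open>m\<close> partition the plane;
  \<open>r = j - b m * k\<close> is the second coordinate of the point where the line through
  \<open>cell i j k\<close> meets the layer \<open>k = 0\<close>.\<close>

lemma UN_troika_of: "(\<Union>r. troika_of m t r) = fan_of m t"
proof -
  have "v \<in> (\<Union>r. troika_of m t r) \<longleftrightarrow> v \<in> fan_of m t" for v
  proof (cases "v \<in> segre \<phi>")
    case True
    then obtain i j k where v: "v = cell i j k"
      by (auto simp: segre_eq)
    have "v \<in> (\<Union>r. troika_of m t r) \<longleftrightarrow>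
        (\<exists>r. i = a m * (s m * (t - c m) - b m * r) + a m * k \<and> j = r + b m * k)"
      by (auto simp: v troika_of_def)
    also have "\<dots> \<longleftrightarrow> i = a m * (s m * (t - c m) - b m * (j - b m * k)) + a m * k"
    proof -
      have "j = r + b m * k \<longleftrightarrow> r = j - b m * k" for r
        by (auto simp: algebra_simps)
      then show ?thesis
        by simp
    qed
    \<comment> \<open>The two terms in \<open>k\<close> combine to \<open>2 * a m * k\<close>, and 2
      = -1.\<close>
    also have "a m * (s m * (t - c m) - b m * (j - b m * k)) + a m * k =
        a m * (s m * (t - c m) - b m * j - k)"
      using signs(2,3)[of m] exhaust_F3[of k] by auto
    also have "i = \<dots> \<longleftrightarrow> k = s m * (t - c m) - a m * i - b m * j"
      using signs(2)[of m] by (auto simp: algebra_simps)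
    finally show ?thesis
      by (simp add: v cell_in_fan_of)
  qed (auto simp: fan_of_def troika_of_def)
  then show ?thesis
    by blast
qed

lemma inj_troika_of: "inj (troika_of m t)"
proof (rule injI)
  fix r r'
  assume "troika_of m t r = troika_of m t r'"
  moreover have "cell (a m * (s m * (t - c m) - b m * r) + a m * 0) (r + b m * 0) 0 \<in> troika_of m t r"
    unfolding troika_of_def by blast
  ultimately show "r = r'"
    unfolding troika_of_def by auto
qed

lemma fan_centre_fan_of: "fan_centre (segre \<phi>) (fan_of m t) = plane_vec m t"
  unfolding fan_centre_def
proof (rule the_equality)
  have "card (range (troika_of m t)) = 3"
    by (simp add: card_image inj_troika_of)
  moreover have "troika_of m t r \<subseteq> fan_of m t" for r
    using UN_troika_of by blast
  ultimately show "\<exists>D. card D = 3 \<and> (\<forall>T\<in>D. troika (segre \<phi>) T \<and> centre T = plane_vec m t) \<and> \<Union>D = fan_of m t"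
    using centre_troika troika_troika_of UN_troika_of
    by (intro exI[of _ "range (troika_of m t)"]) blast
next
  fix v
  assume "\<exists>D. card D = 3 \<and> (\<forall>T\<in>D. troika (segre \<phi>) T \<and> centre T = v) \<and> \<Union>D = fan_of m t"
  then show "v = plane_vec m t"
  proof (elim exE conjE)
    fix D
    assume D: "card D = 3" "\<forall>T\<in>D. troika (segre \<phi>) T \<and> centre T = v" "\<Union>D = fan_of m t"
    from D(1) have "D \<noteq> {}"
      by auto
    then obtain T where "T \<in> D"
      by blast
    then have "troika (segre \<phi>) T" "centre T = v" "T \<subseteq> fan_of m t"
      using D(2,3) by auto
    then show "v = plane_vec m t"
      using centre_troika by simp
  qed
qed

lemma triplet_line_range_fan_of: "triplet_line (segre \<phi>) (range (fan_of m)) = range (plane_vec m)"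
  by (simp add: triplet_line_def image_image fan_centre_fan_of)

end

section \<open>From labels back to the four lines\<close>

lemma range_plane_vec: "range (plane_vec m) = proj_space (plane (fst_ix m) (snd_ix m))"
proof (intro equalityI subsetI)
  fix v
  assume "v \<in> range (plane_vec m)"
  then obtain t where "v = plane_vec m t"
    by blast
  moreover have "plane_vec m t \<in> plane (fst_ix m) (snd_ix m)"
    unfolding plane_vec_def plane_def by (intro vec.span_add vec.span_scale vec.span_base) auto
  moreover have "plane_vec m t \<noteq> 0"
    using exhaust_F3[of t] by (auto simp: V8_eq_iff)
  ultimately show "v \<in> proj_space (plane (fst_ix m) (snd_ix m))"
    by (simp add: proj_space_def)
next
  fix v
  assume "v \<in> proj_space (plane (fst_ix m) (snd_ix m))"
  then have "v \<noteq> 0" "v \<in> vec.span {basis_vec (fst_ix m), basis_vec (snd_ix m)}"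
    by (auto simp: proj_space_def plane_def)
  then obtain x y where v: "v = x *s basis_vec (fst_ix m) + y *s basis_vec (snd_ix m)"
    by (auto simp: vec.span_insert vec.span_singleton algebra_simps)
  have "v = plane_vec m (if x = y then 0 else if x = 1 then 1 else 2)"
    using \<open>v \<noteq> 0\<close> by (cases x; cases y; simp add: v plane_vec_def)
  then show "v \<in> range (plane_vec m)"
    by blast
qed

lemma inj_range_plane_vec: "inj (\<lambda>m. range (plane_vec m))"
proof (rule injI)
  fix m n
  assume "range (plane_vec m) = range (plane_vec n)"
  then obtain t where "plane_vec m 0 = plane_vec n t"
    by blast
  then have "plane_vec m 0 $ fst_ix m = plane_vec n t $ fst_ix m"
    by simp
  then show "m = n"
    by (auto split: if_splits)
qed

text \<open>Needed because \<open>fst_ix\<close> and \<open>snd_ix\<close> follow the order of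
  \<open>zeta\<close>, which for \<open>V_b\<close> and \<open>V_d\<close> is the reverse of the
  order in their definitions.\<close>

lemma plane_commute: "plane s t = plane t s"
  by (simp add: plane_def insert_commute)

theorem theorem11:
  fixes \<phi> :: "tensor3 \<Rightarrow> V8" and S :: "V8 set"
  assumes "linear_iso \<phi>" and "S = segre \<phi>" and "S \<subseteq> omega4"
  shows "card (fan_triplets \<phi>) = 4 \<and>
         triplet_line S ` fan_triplets \<phi> =
           {proj_space V_a, proj_space V_b, proj_space V_c, proj_space V_d}"
proof -
  interpret segre_in_omega4 \<phi>
    using assms by unfold_locales auto
  obtain s a b c where "labelled_segre \<phi> s a b c"
    using ex_labelled_segre by blast
  then interpret labelled_segre \<phi> s a b c .
  have line: "triplet_line S (range (fan_of m)) = range (plane_vec m)" for m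
    by (simp add: assms(2) triplet_line_range_fan_of)
  \<comment> \<open>The four triplets are told apart by their lines.\<close>
  then have "inj (\<lambda>m. range (fan_of m))"
    using inj_range_plane_vec unfolding inj_def by metis
  then have "card (fan_triplets \<phi>) = 4"
    by (simp add: fan_triplets_eq card_image)
  moreover have "triplet_line S ` fan_triplets \<phi> = (\<lambda>m. proj_space (plane (fst_ix m) (snd_ix m))) ` UNIV"
    by (simp add: fan_triplets_eq image_image line range_plane_vec)
  then have "triplet_line S ` fan_triplets \<phi> =
      {proj_space V_a, proj_space V_b, proj_space V_c, proj_space V_d}"
    unfolding UNIV_4
    by (simp add: fst_ix_def snd_ix_def V_a_def V_b_def V_c_def V_d_def plane_commute[of 7]
        plane_commute[of 5])
  ultimately show ?thesis
    by blast
qed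

end
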